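(* Let $n\ge 2$ and $\mu\ge 1$ be integers, and let $\mathscr{D}$ be an affine $(v,k,\lambda)$-design with $v=n^2\mu$ points and $b=\frac{n^3\mu-n}{n-1}$ blocks, where $n=v/k$ is the number of blocks in each parallel class and $\mu$ is the number of points in which any two distinct non-parallel blocks intersect. Let $G$ be the incidence graph of $\mathscr{D}$. Then the distance signature of $G$ is $$ \operatorname{sig}(G)=\begin{cases} (1,4,5) & \text{if } (n,\mu)=(2,1),\\ (4\mu,\,4\mu,\,4\mu-2) & \text{if } n=2,\ \mu\ge 2,\\ (b,\,v,\,0) & \text{otherwise.} \end{cases} $$
   Context: Designs. A design is a pair $\mathscr{D}=(V,\mathcal{B})$ with $V$ a finite set (points) and $\mathcal{B}$ a set of subsets of $V$ (blocks). It is a $(v,k,\lambda)$-design if $|V|=v$, every block contains exactly $k$ points, and every 2-subset of $V$ is contained in precisely $\lambda$ blocks. Then every point lies in exactly $r=\lambda(v-1)/(k-1)$ blocks, and the number of blocks is $b=|\mathcal{B}|=vr/k$. A parallel class is a set of blocks forming a partition of $V$. The design is resolvable if $\mathcal{B}$ admits a partition $\mathcal{B}=\mathcal{C}_1\cup\dots\cup\mathcal{C}_r$ into parallel classes; blocks in the same class are called parallel. A resolvable $(v,k,\lambda)$-design is affine if any two distinct non-parallel blocks intersect in exactly $\mu$ points, for a constant $\mu$. Each parallel class has $n=v/k$ blocks, and the parameters are $$v=nk=n^2\mu,\quad k=n\mu,\quad \lambda=\frac{n\mu-1}{n-1},\quad r=\frac{n^2\mu-1}{n-1},\quad b=v+r-1=\frac{n(n^2\mu-1)}{n-1}.$$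 Incidence graph. The incidence graph of $\mathscr{D}=(V,\mathcal{B})$ is the bipartite graph with vertex set the disjoint union $V\cup\mathcal{B}$, in which $V$ and $\mathcal{B}$ are independent sets and a point $p\in V$ is adjacent to a block $B\in\mathcal{B}$ if and only if $p\in B$. Distance signature. For a connected graph $G$, the distance matrix $D(G)$ is the real symmetric matrix with rows and columns indexed by the vertices whose $(x,y)$ entry is the length of a shortest path between $x$ and $y$. For a real symmetric matrix $A$, the signature is $\operatorname{sig}(A)=(n_+(A),n_-(A),n_0(A))$, where $n_+(A),n_-(A),n_0(A)$ are the numbers of positive, negative and zero eigenvalues of $A$, counted with multiplicity. The distance signature of $G$ is $\operatorname{sig}(G)=\operatorname{sig}(D(G))$. *)

theory Defs
  imports
    Complex_Main
    "HOL-Library.Disjoint_Sets"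
    "Graph_Theory.Graph_Theory"
    "Jordan_Normal_Form.Char_Poly"
begin

definition vkl_design :: "'a set \<Rightarrow> 'a set set \<Rightarrow> nat \<Rightarrow> nat \<Rightarrow> nat \<Rightarrow> bool" where
  "vkl_design V \<B> v k l \<longleftrightarrow>
     finite V \<and> (\<forall>B\<in>\<B>. B \<subseteq> V) \<and> card V = v \<and> (\<forall>B\<in>\<B>. card B = k) \<and>
     (\<forall>S. S \<subseteq> V \<and> card S = 2 \<longrightarrow> card {B \<in> \<B>. S \<subseteq> B} = l)"

definition parallel_class :: "'a set \<Rightarrow> 'a set set \<Rightarrow> 'a set set \<Rightarrow> bool" where
  "parallel_class V \<B> C \<longleftrightarrow> C \<subseteq> \<B> \<and> partition_on V C"

text \<open>The number of classes is not prescribed: each class covers every point exactly once, so it is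
  the number of blocks through any given point.\<close>

definition resolution :: "'a set \<Rightarrow> 'a set set \<Rightarrow> 'a set set set \<Rightarrow> bool" where
  "resolution V \<B> \<C> \<longleftrightarrow> partition_on \<B> \<C> \<and> (\<forall>C\<in>\<C>. parallel_class V \<B> C)"

definition affine_design ::
    "'a set \<Rightarrow> 'a set set \<Rightarrow> nat \<Rightarrow> nat \<Rightarrow> nat \<Rightarrow> nat \<Rightarrow> bool" where
  "affine_design V \<B> v k l \<mu> \<longleftrightarrow>
     vkl_design V \<B> v k l \<and>
     (\<exists>\<C>. resolution V \<B> \<C> \<and>
          (\<forall>C\<in>\<C>. \<forall>D\<in>\<C>. C \<noteq> D \<longrightarrow> (\<forall>A\<in>C. \<forall>B\<in>D. card (A \<inter> B) = \<mu>)))"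

text \<open>An undirected edge is represented by the two opposite arcs.\<close>

definition incidence_graph :: "'a set \<Rightarrow> 'a set set \<Rightarrow> ('a + 'a set) pair_pre_digraph" where
  "incidence_graph V \<B> =
     \<lparr> pverts = V <+> \<B>,
       parcs = {(Inl p, Inr B) | p B. p \<in> V \<and> B \<in> \<B> \<and> p \<in> B} \<union>
               {(Inr B, Inl p) | p B. p \<in> V \<and> B \<in> \<B> \<and> p \<in> B} \<rparr>"

lemma pair_graph_incidence_graph:
  assumes "finite V" and "\<forall>B\<in>\<B>. B \<subseteq> V"
  shows "pair_graph (incidence_graph V \<B>)"
proof -
  have fB: "finite \<B>"
    using assms by (meson PowI finite_Pow_iff finite_subset subsetI)
  have sub: "parcs (incidence_graph V \<B>) \<subseteq> (V <+> \<B>) \<times> (V <+> \<B>)"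
    by (auto simp: incidence_graph_def)
  have fin: "finite (parcs (incidence_graph V \<B>))"
    by (rule finite_subset[OF sub]) (use assms(1) fB in auto)
  show ?thesis
    by unfold_locales
      (use assms(1) fB fin in \<open>auto simp: incidence_graph_def symmetric_def sym_def\<close>)
qed

text \<open>Meaningful only if \<open>y\<close> is reachable from \<open>x\<close>.  Paths are lists of arcs, so the list length
  is the number of edges.\<close>

definition graph_dist :: "'b pair_pre_digraph \<Rightarrow> 'b \<Rightarrow> 'b \<Rightarrow> nat" where
  "graph_dist G x y =
     (LEAST d. \<exists>p. pre_digraph.apath (with_proj G) x p y \<and> length p = d)"

text \<open>The list \<open>xs\<close> is an enumeration of the vertices without repetitions.  The choice of \<open>xs\<close>
  changes the matrix only by a simultaneous permutation of rows and columns.\<close>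

definition distance_matrix :: "'b pair_pre_digraph \<Rightarrow> 'b list \<Rightarrow> real mat" where
  "distance_matrix G xs =
     mat (length xs) (length xs) (\<lambda>(i, j). real (graph_dist G (xs ! i) (xs ! j)))"

text \<open>The multiplicity of an eigenvalue is its multiplicity as a root of the characteristic
  polynomial, which is the dimension of the eigenspace when the matrix is real symmetric.\<close>

definition num_eigenvalues :: "(real \<Rightarrow> bool) \<Rightarrow> real mat \<Rightarrow> nat" where
  "num_eigenvalues P A = (\<Sum>x | eigenvalue A x \<and> P x. order x (char_poly A))"

definition signature :: "real mat \<Rightarrow> nat \<times> nat \<times> nat" where
  "signature A =
     (num_eigenvalues (\<lambda>x. x > 0) A, num_eigenvalues (\<lambda>x. x < 0) A,
      num_eigenvalues (\<lambda>x. x = 0) A)"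

end

theory Submission
  imports Defs
begin

text \<open>
  Let \<open>N\<close> be the incidence matrix of points and blocks, \<open>K\<close> the matrix of the relation of being parallel
  or equal on blocks, and \<open>J\<close> an all-ones matrix of any shape. Distinct points have distance 2, a
  point and a block have distance 1 if they are incident and 3 otherwise, and distinct blocks have
  distance 4 if they are parallel and 2 otherwise (\<open>graph_dist_eq_separation\<close>). Hence the distance matrix is
  \<open>D = ((2J - 2, 3J - 2N), (3J - 2N\<^sup>T, 2J + 2K - 4))\<close>.

  Write \<open>r\<close> for the number of parallel classes. The space on which \<open>D\<close> acts splits into three invariant
  parts. Vectors on blocks that are constant on classes and have sum zero are annihilated by \<open>N\<close> and
  \<open>J\<close>, and \<open>D\<close> acts on them as \<open>2n - 4\<close>, with multiplicity \<open>r - 1\<close>. A vector \<open>x\<close> on points with sum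
  zero spans together with \<open>N\<^sup>T x\<close> a plane on which \<open>D\<close> has the characteristic polynomial
  \<open>t\<^sup>2 + 6t + 8 - 4k\<close>; there are \<open>v - 1\<close> independent such planes. Finally \<open>D\<close> acts on the two constant vectors with a quadratic characteristic
  polynomial, whose constant term is negative (\<open>determinant_on_constants_negative\<close>), so that it contributes
  one positive and one negative eigenvalue.

  The middle quadratic contributes \<open>v - 1\<close> eigenvalues of each sign when \<open>k > 2\<close>. When \<open>k = 2\<close>, that is
  \<open>n = 2\<close> and \<open>\<mu> = 1\<close>, its roots are \<open>0\<close> and \<open>-6\<close>. The eigenvalue \<open>2n - 4\<close> is zero for \<open>n = 2\<close> and positive
  otherwise. Together with \<open>b + 1 = v + r\<close> this gives the three cases.

  Instead of exhibiting eigenvectors, the proof computes \<open>det (t - D)\<close> for all large \<open>t\<close>. A Schur complement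
  eliminates the points, and what is left on the blocks is a combination of the identity, \<open>J\<close> and \<open>K\<close>,
  whose determinant follows from Sylvester's identity (\<open>det_parallel_algebra\<close>, \<open>det_separation\<close>). Agreement
  for all large \<open>t\<close> determines the characteristic polynomial (\<open>char_poly_distance_matrix\<close>).
\<close>

section \<open>Matrices indexed by lists and their determinants\<close>

text \<open>Rows and columns are named by the entries of two lists, so that products and entrywise
  identities can be stated in terms of points, blocks and classes instead of positions.\<close>

definition tab :: "'a list \<Rightarrow> 'b list \<Rightarrow> ('a \<Rightarrow> 'b \<Rightarrow> 'c) \<Rightarrow> 'c mat" where
  "tab xs ys f = mat (length xs) (length ys) (\<lambda>(i, j). f (xs ! i) (ys ! j))"

lemma tab_carrier [simp]: "tab xs ys f \<in> carrier_mat (length xs) (length ys)"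
  by (simp add: tab_def)

lemma tab_cong:
  assumes "\<And>x y. x \<in> set xs \<Longrightarrow> y \<in> set ys \<Longrightarrow> f x y = g x y"
  shows "tab xs ys f = tab xs ys g"
  using assms by (auto simp: tab_def intro!: eq_matI)

lemma tab_mult:
  fixes f :: "'a \<Rightarrow> 'b \<Rightarrow> 'c::comm_semiring_1"
  assumes "distinct ys"
  shows "tab xs ys f * tab ys zs g = tab xs zs (\<lambda>x z. \<Sum>y\<in>set ys. f x y * g y z)"
proof -
  have "(\<Sum>y\<in>set ys. h y) = (\<Sum>j = 0..<length ys. h (ys ! j))" for h :: "'b \<Rightarrow> 'c"
    using sum.reindex_bij_betw[OF bij_betw_nth[OF assms refl refl], of h]
    by (simp add: atLeast0LessThan)
  then show ?thesis
    by (auto simp: tab_def scalar_prod_def intro!: eq_matI)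
qed

lemma tab_one: "distinct xs \<Longrightarrow> tab xs xs (\<lambda>x y. if x = y then 1 else 0) = 1\<^sub>m (length xs)"
  by (auto simp: tab_def nth_eq_iff_index_eq intro!: eq_matI)

lemma tab_sum:
  "tab (map Inl xs @ map Inr ys) (map Inl xs @ map Inr ys) f =
   four_block_mat (tab xs xs (\<lambda>x y. f (Inl x) (Inl y))) (tab xs ys (\<lambda>x y. f (Inl x) (Inr y)))
     (tab ys xs (\<lambda>x y. f (Inr x) (Inl y))) (tab ys ys (\<lambda>x y. f (Inr x) (Inr y)))"
  by (auto simp: tab_def nth_append intro!: eq_matI)

text \<open>Two enumerations of the same set give matrices that are conjugate under the permutation
  matrix whose entry is 1 where the row and the column carry the same name.\<close>

lemma char_poly_tab_permute:
  fixes f :: "'a \<Rightarrow> 'a \<Rightarrow> 'c::comm_ring_1"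
  assumes xs: "distinct xs" and ys: "distinct ys" and eq: "set xs = set ys"
  shows "char_poly (tab xs xs f) = char_poly (tab ys ys f)"
proof -
  let ?I = "\<lambda>x y. if x = y then 1 else 0 :: 'c"
  have len: "length xs = length ys"
    using assms by (metis distinct_card)
  have inv: "tab us ws ?I * tab ws us ?I = 1\<^sub>m (length us)"
    if "distinct us" "distinct ws" "set us = set ws" for us ws :: "'a list"
    unfolding tab_mult[OF that(2)] tab_one[OF that(1), symmetric]
    by (rule tab_cong) (use that in \<open>auto simp: if_distrib[of "\<lambda>z. z * _"] cong: if_cong\<close>)
  have PQ: "tab xs ys ?I * tab ys xs ?I = 1\<^sub>m (length xs)"
    "tab ys xs ?I * tab xs ys ?I = 1\<^sub>m (length xs)"
    using inv[OF xs ys eq] inv[OF ys xs eq[symmetric]] len by auto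
  have "tab xs xs f = tab xs ys ?I * tab ys ys f * tab ys xs ?I"
    unfolding tab_mult[OF ys]
    by (rule tab_cong)
      (auto simp: eq if_distrib[of "\<lambda>z. z * _"] if_distrib[of "\<lambda>z. _ * z"] cong: if_cong)
  then have "similar_mat_wit (tab xs xs f) (tab ys ys f) (tab xs ys ?I) (tab ys xs ?I)"
    unfolding similar_mat_wit_def Let_def
    using PQ len
    by (metis (no_types, lifting) carrier_matD(1) insert_subset subset_insertI2 empty_subsetI tab_carrier)
  then show ?thesis
    by (intro char_poly_similar) (auto simp: similar_mat_def)
qed

lemma poly_char_poly_tab:
  fixes f :: "'a \<Rightarrow> 'a \<Rightarrow> 'c::field"
  assumes "distinct xs"
  shows "poly (char_poly (tab xs xs f)) t = det (tab xs xs (\<lambda>x y. (if x = y then t else 0) - f x y))"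
  unfolding char_poly_def
  by (rule poly_det_cong[of _ "length xs"])
    (use assms in \<open>auto simp: char_poly_matrix_def tab_def nth_eq_iff_index_eq\<close>)

text \<open>The Schur complement, with the inverse of the upper left block hidden in a solution \<open>X\<close> of
  \<open>A X = B\<close>: subtracting the first block column times \<open>X\<close> from the second makes the matrix block
  triangular.\<close>

lemma det_four_block_Schur:
  fixes A :: "'c::idom mat"
  assumes A: "A \<in> carrier_mat n n" and X: "X \<in> carrier_mat n m"
    and C: "C \<in> carrier_mat m n" and D: "D \<in> carrier_mat m m"
  shows "det (four_block_mat A (A * X) C D) = det A * det (D - C * X)"
proof -
  have DCX: "C * X + (D - C * X) = D"
    using A X C D by (intro eq_matI) auto
  have "four_block_mat A (A * X) C D =
    four_block_mat A (0\<^sub>m n m) C (D - C * X) * four_block_mat (1\<^sub>m n) X (0\<^sub>m m n) (1\<^sub>m m)"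
    by (subst mult_four_block_mat[of _ n n _ m _ m _ _ n _ m])
      (use A X C D DCX in \<open>auto simp: minus_carrier_mat\<close>)
  moreover have "det (four_block_mat A (0\<^sub>m n m) C (D - C * X)) = det A * det (D - C * X)"
    by (rule det_four_block_mat_upper_right_zero[of _ n _ m])
      (use A X C D in \<open>auto simp: minus_carrier_mat\<close>)
  moreover have "det (four_block_mat (1\<^sub>m n) X (0\<^sub>m m n) (1\<^sub>m m)) = 1"
    by (subst det_four_block_mat_lower_left_zero[of _ n _ m]) (use X in auto)
  moreover have "four_block_mat A (0\<^sub>m n m) C (D - C * X) \<in> carrier_mat (n + m) (n + m)"
    "four_block_mat (1\<^sub>m n) X (0\<^sub>m m n) (1\<^sub>m m) \<in> carrier_mat (n + m) (n + m)"
    using A X C D by auto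
  ultimately show ?thesis by (simp add: det_mult)
qed

text \<open>Both sides are the determinant of \<open>((1, V), (-U, a))\<close>, taken once by eliminating the upper right
  block with the pivot 1 and once by eliminating the lower left block with the pivot \<open>a\<close>.\<close>

lemma det_Sylvester:
  fixes U :: "'c::field mat"
  assumes U: "U \<in> carrier_mat m n" and V: "V \<in> carrier_mat n m" and a: "a \<noteq> 0"
  shows "det (a \<cdot>\<^sub>m 1\<^sub>m m + U * V) = a ^ m * det (1\<^sub>m n + (1 / a) \<cdot>\<^sub>m (V * U))"
proof -
  let ?M = "four_block_mat (1\<^sub>m n) V (- U) (a \<cdot>\<^sub>m 1\<^sub>m m)"
  let ?W = "(1 / a) \<cdot>\<^sub>m U"
  let ?S = "1\<^sub>m n + V * ?W"
  have aW: "(a \<cdot>\<^sub>m 1\<^sub>m m) * (- ?W) = - U"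
    using U a by (subst mult_smult_assoc_mat) (auto intro!: eq_matI)
  have "a \<cdot>\<^sub>m 1\<^sub>m m - - (U * V) = a \<cdot>\<^sub>m 1\<^sub>m m + U * V"
    using U V by (intro eq_matI) auto
  then have "det ?M = det (a \<cdot>\<^sub>m 1\<^sub>m m + U * V)"
    using det_four_block_Schur[of "1\<^sub>m n" n V m "- U" "a \<cdot>\<^sub>m 1\<^sub>m m"] U V
    by simp
  moreover have "?M = four_block_mat ?S V (0\<^sub>m m n) (a \<cdot>\<^sub>m 1\<^sub>m m) *
     four_block_mat (1\<^sub>m n) (0\<^sub>m n m) (- ?W) (1\<^sub>m m)"
  proof -
    have "?S + V * (- ?W) = 1\<^sub>m n"
      using U V by (intro eq_matI) auto
    then show ?thesis
      by (subst mult_four_block_mat[of _ n n _ m _ m _ _ n _ m]) (use U V aW in auto)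
  qed
  moreover have "det (four_block_mat ?S V (0\<^sub>m m n) (a \<cdot>\<^sub>m 1\<^sub>m m)) = det ?S * a ^ m"
    by (subst det_four_block_mat_lower_left_zero[of _ n _ m]) (use U V in auto)
  moreover have "det (four_block_mat (1\<^sub>m n) (0\<^sub>m n m) (- ?W) (1\<^sub>m m)) = 1"
    by (subst det_four_block_mat_upper_right_zero[of _ n _ m]) (use U in auto)
  moreover have "four_block_mat ?S V (0\<^sub>m m n) (a \<cdot>\<^sub>m 1\<^sub>m m) \<in> carrier_mat (n + m) (n + m)"
    "four_block_mat (1\<^sub>m n) (0\<^sub>m n m) (- ?W) (1\<^sub>m m) \<in> carrier_mat (n + m) (n + m)"
    using U V by auto
  moreover have "?S = 1\<^sub>m n + (1 / a) \<cdot>\<^sub>m (V * U)"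
    using U V by (simp add: mult_smult_distrib)
  ultimately show ?thesis by (simp add: det_mult mult.commute)
qed

lemma det_tab_Schur:
  fixes a b c :: "_ \<Rightarrow> _ \<Rightarrow> 'c::idom"
  assumes xs: "distinct xs"
    and b: "\<And>x y. x \<in> set xs \<Longrightarrow> y \<in> set ys \<Longrightarrow> b x y = (\<Sum>z\<in>set xs. a x z * u z y)"
  shows "det (four_block_mat (tab xs xs a) (tab xs ys b) (tab ys xs c) (tab ys ys d)) =
    det (tab xs xs a) * det (tab ys ys (\<lambda>x y. d x y - (\<Sum>z\<in>set xs. c x z * u z y)))"
proof -
  have "tab xs ys b = tab xs xs a * tab xs ys u"
    unfolding tab_mult[OF xs] by (rule tab_cong) (rule b)
  moreover have "tab ys ys (\<lambda>x y. d x y - (\<Sum>z\<in>set xs. c x z * u z y)) = tab ys ys d - tab ys xs c * tab xs ys u"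
    unfolding tab_mult[OF xs] by (auto simp: tab_def intro!: eq_matI)
  ultimately show ?thesis
    by (simp add: det_four_block_Schur[of _ "length xs" _ "length ys"])
qed

lemma det_tab_Sylvester:
  fixes u v :: "_ \<Rightarrow> _ \<Rightarrow> 'c::field"
  assumes xs: "distinct xs" and ys: "distinct ys" and "a \<noteq> 0"
  shows "det (tab xs xs (\<lambda>x x'. (if x = x' then a else 0) + (\<Sum>y\<in>set ys. u x y * v y x'))) =
    a ^ length xs * det (tab ys ys (\<lambda>y y'. (if y = y' then 1 else 0) + (\<Sum>x\<in>set xs. v y x * u x y') / a))"
proof -
  have "tab xs xs (\<lambda>x x'. (if x = x' then a else 0) + (\<Sum>y\<in>set ys. u x y * v y x')) =
    a \<cdot>\<^sub>m 1\<^sub>m (length xs) + tab xs ys u * tab ys xs v"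
    unfolding tab_mult[OF ys] tab_one[OF xs, symmetric] by (auto simp: tab_def intro!: eq_matI)
  moreover have "tab ys ys (\<lambda>y y'. (if y = y' then 1 else 0) + (\<Sum>x\<in>set xs. v y x * u x y') / a) =
    1\<^sub>m (length ys) + (1 / a) \<cdot>\<^sub>m (tab ys xs v * tab xs ys u)"
    unfolding tab_mult[OF xs] tab_one[OF ys, symmetric] by (auto simp: tab_def intro!: eq_matI)
  ultimately show ?thesis
    using det_Sylvester[of "tab xs ys u" "length xs" "length ys" "tab ys xs v" a] assms by simp
qed

text \<open>The constant part has rank one, so Sylvester's identity reduces the determinant to a single
  entry, indexed by the unit type.\<close>

lemma det_tab_scalar_plus_constant:
  fixes a b :: "'c::field"
  assumes xs: "distinct xs" and a: "a \<noteq> 0"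
  shows "det (tab xs xs (\<lambda>x y. (if x = y then a else 0) + b)) =
    a ^ length xs * (1 + of_nat (length xs) * b / a)"
proof -
  have "det (tab [()] [()] g) = g () ()" for g :: "unit \<Rightarrow> unit \<Rightarrow> 'c"
    by (subst det_single) (auto simp: tab_def)
  then show ?thesis
    using det_tab_Sylvester[OF xs, of "[()]" a "\<lambda>_ _. 1" "\<lambda>_ _. b"] a
    by (simp add: distinct_card[OF xs])
qed

section \<open>Spectra from factored characteristic polynomials\<close>

text \<open>Once a characteristic polynomial is written as a product of linear factors, a signature is
  found by counting in the list of roots.\<close>

lemma num_eigenvalues_linear_factors:
  assumes A: "A \<in> carrier_mat m m" and char: "char_poly A = (\<Prod>a\<leftarrow>as. [:- a, 1:])"
  shows "num_eigenvalues P A = length (filter P as)"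
proof -
  have eig: "eigenvalue A x \<longleftrightarrow> x \<in> set as" for x
    unfolding eigenvalue_root_char_poly[OF A] char by (induction as) auto
  have ord: "order x (\<Prod>a\<leftarrow>as. [:- a, 1:]) = count_list as x" for x
  proof (induction as)
    case (Cons a as)
    have "(\<Prod>a\<leftarrow>as. [:- a, 1:]) \<noteq> 0" by (auto simp: prod_list_zero_iff)
    then have "[:- a, 1:] * (\<Prod>a\<leftarrow>as. [:- a, 1:]) \<noteq> 0" by (simp del: mult_pCons_left)
    then show ?case using Cons by (simp add: order_mult order_linear' del: mult_pCons_left)
  qed (simp add: order_0I)
  have "num_eigenvalues P A = (\<Sum>x\<in>set (filter P as). count_list (filter P as) x)"
    unfolding num_eigenvalues_def eig char ord
    by (rule sum.cong) (auto simp: count_list_eq_length_filter intro!: arg_cong[where f=length] filter_cong)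
  also have "\<dots> = length (filter P as)" by (rule sum_count_set) auto
  finally show ?thesis .
qed

text \<open>This lets a polynomial identity be proved at those points only where no pivot vanishes.\<close>

lemma poly_eqI_large:
  fixes p q :: "real poly"
  assumes "\<And>t. t > T \<Longrightarrow> poly p t = poly q t"
  shows "p = q"
proof (rule ccontr)
  assume "p \<noteq> q"
  then have "finite {t. poly (p - q) t = 0}" by (intro poly_roots_finite) simp
  moreover have "{T<..} \<subseteq> {t. poly (p - q) t = 0}" using assms by auto
  ultimately show False using infinite_Ioi finite_subset by blast
qed

lemma monic_quadratic_factors:
  fixes p q :: real
  assumes "p\<^sup>2 \<ge> 4 * q"
  obtains x y where "\<And>t. t\<^sup>2 + p * t + q = (t - x) * (t - y)" "x * y = q" "x + y = - p"
proof
  let ?d = "sqrt (p\<^sup>2 - 4 * q)"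
  have d: "?d\<^sup>2 = p\<^sup>2 - 4 * q" using assms by simp
  show "((- p + ?d) / 2) * ((- p - ?d) / 2) = q"
    using d by (simp add: field_simps power2_eq_square)
  then show "t\<^sup>2 + p * t + q = (t - (- p + ?d) / 2) * (t - (- p - ?d) / 2)" for t
    by (simp add: field_simps power2_eq_square)
  show "(- p + ?d) / 2 + (- p - ?d) / 2 = - p" by (simp add: field_simps)
qed

section \<open>Distances in the incidence graph\<close>

text \<open>Walks alternate between points and blocks, so lower bounds on distances need to exclude lengths of
  one parity only.\<close>

lemma walk_length_parity:
  assumes "pcas x p y" "set p \<subseteq> parcs (incidence_graph V \<B>)"
  shows "even (length p) \<longleftrightarrow> isl x = isl y"
  using assms by (induction p arbitrary: x) (auto simp: incidence_graph_def)

lemma apath_with_proj_iff: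
  "pre_digraph.apath (with_proj G) x p y \<longleftrightarrow>
     x \<in> pverts G \<and> set p \<subseteq> parcs G \<and> pcas x p y \<and> distinct (pawalk_verts x p)"
  by (simp add: pre_digraph.apath_def pre_digraph.awalk_def cas_with_proj_eq awalk_verts_with_proj_eq)

lemma graph_dist_eqI:
  assumes "pre_digraph.apath (with_proj G) x p y" "length p = d"
    and "\<And>p. pre_digraph.apath (with_proj G) x p y \<Longrightarrow> d \<le> length p"
  shows "graph_dist G x y = d"
  unfolding graph_dist_def by (rule Least_equality) (use assms in auto)

text \<open>A common block of two points is what the positivity of \<open>\<lambda>\<close> provides; it makes all distances between
  points equal to 2 and, as \<open>n \<ge> 2\<close>, forces a second parallel class.\<close>

locale affine_resolution =
  fixes V :: "'a set" and \<B> :: "'a set set" and \<C> :: "'a set set set" and k n \<mu> :: nat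
  assumes finite_points: "finite V"
    and block_subset: "B \<in> \<B> \<Longrightarrow> B \<subseteq> V"
    and card_block: "B \<in> \<B> \<Longrightarrow> card B = k"
    and classes: "resolution V \<B> \<C>"
    and card_Int: "\<lbrakk>C \<in> \<C>; D \<in> \<C>; C \<noteq> D; A \<in> C; B \<in> D\<rbrakk> \<Longrightarrow> card (A \<inter> B) = \<mu>"
    and card_points: "card V = n * k"
    and block_size: "k = n * \<mu>"
    and positive: "0 < k" "0 < \<mu>"
    and n_ge_2: "2 \<le> n" and nonempty: "\<B> \<noteq> {}"
    and common_block: "\<lbrakk>p \<in> V; q \<in> V; p \<noteq> q\<rbrakk> \<Longrightarrow> \<exists>B\<in>\<B>. p \<in> B \<and> q \<in> B"
begin

text \<open>Every block is parallel to itself, so this is the relation whose matrix is the all-ones matrix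
  on each parallel class.\<close>

definition parallel :: "'a set \<Rightarrow> 'a set \<Rightarrow> bool" where
  "parallel A B \<longleftrightarrow> (\<exists>C\<in>\<C>. A \<in> C \<and> B \<in> C)"

lemma finite_blocks: "finite \<B>"
  using finite_points block_subset by (meson PowI finite_Pow_iff finite_subset subsetI)

lemma finite_block: "B \<in> \<B> \<Longrightarrow> finite B"
  using block_subset finite_points finite_subset by blast

lemma class_subset: "C \<in> \<C> \<Longrightarrow> C \<subseteq> \<B>"
  using classes by (auto simp: resolution_def parallel_class_def)

lemma finite_class: "C \<in> \<C> \<Longrightarrow> finite C"
  using class_subset finite_blocks finite_subset by blast

lemma partition_classes: "partition_on \<B> \<C>"
  using classes by (auto simp: resolution_def)

lemma partition_class: "C \<in> \<C> \<Longrightarrow> partition_on V C"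
  using classes by (auto simp: resolution_def parallel_class_def)

lemma finite_classes: "finite \<C>"
  using finite_elements[OF finite_blocks partition_classes] .

lemma ex_class: "B \<in> \<B> \<Longrightarrow> \<exists>C\<in>\<C>. B \<in> C"
  using partition_onD1[OF partition_classes] by auto

lemma class_unique: "\<lbrakk>C \<in> \<C>; D \<in> \<C>; B \<in> C; B \<in> D\<rbrakk> \<Longrightarrow> C = D"
  using disjointD[OF partition_onD2[OF partition_classes], of C D] by auto

lemma card_class: assumes "C \<in> \<C>" shows "card C = n"
proof -
  have "k * card C = card (\<Union>C)"
    using partition_class[OF assms] class_subset[OF assms] finite_points
    by (intro card_partition) (auto simp: partition_on_def disjoint_def finite_class[OF assms] card_block)
  also have "\<dots> = n * k"
    using partition_class[OF assms] card_points by (simp add: partition_on_def)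
  finally show ?thesis using positive by simp
qed

lemma card_blocks: "card \<B> = n * card \<C>"
proof -
  have "n * card \<C> = card (\<Union>\<C>)"
    using partition_classes finite_blocks
    by (intro card_partition) (auto simp: partition_on_def disjoint_def finite_classes card_class)
  then show ?thesis using partition_classes by (simp add: partition_on_def)
qed

lemma parallel_refl: "B \<in> \<B> \<Longrightarrow> parallel B B"
  using ex_class by (auto simp: parallel_def)

lemma parallel_distinct_disjoint: "\<lbrakk>parallel A B; A \<noteq> B\<rbrakk> \<Longrightarrow> A \<inter> B = {}"
  using disjointD[OF partition_onD2[OF partition_class]] by (auto simp: parallel_def)

lemma card_Int_nonparallel:
  assumes "A \<in> \<B>" "B \<in> \<B>" "\<not> parallel A B"
  shows "card (A \<inter> B) = \<mu>"
proof -
  obtain C D where "C \<in> \<C>" "A \<in> C" "D \<in> \<C>" "B \<in> D"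
    using ex_class[OF assms(1)] ex_class[OF assms(2)] by auto
  then show ?thesis using assms(3) by (intro card_Int) (auto simp: parallel_def)
qed

lemma card_Int_blocks:
  assumes "A \<in> \<B>" "B \<in> \<B>"
  shows "card (A \<inter> B) = (if A = B then k else if parallel A B then 0 else \<mu>)"
  using assms card_block card_Int_nonparallel parallel_distinct_disjoint by auto

lemma ex_point: "B \<in> \<B> \<Longrightarrow> \<exists>p. p \<in> B \<and> p \<in> V"
  using card_block[of B] positive block_subset[of B] card_gt_0_iff[of B] by blast

text \<open>A block misses some point \<open>q\<close>; a block joining \<open>q\<close> to a point of the given one meets it without being
  equal to it, hence lies in another class.\<close>

lemma ex_nonparallel:
  assumes "B \<in> \<B>"
  obtains A where "A \<in> \<B>" "\<not> parallel A B"
proof -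
  obtain p where p: "p \<in> B" "p \<in> V" using ex_point[OF assms] by blast
  have "card B < card V" using card_block[OF assms] card_points n_ge_2 positive by simp
  then obtain q where q: "q \<in> V" "q \<notin> B"
    using card_mono[OF finite_block[OF assms], of V] by auto
  obtain A where A: "A \<in> \<B>" "p \<in> A" "q \<in> A" using common_block[of p q] p q by auto
  then have "\<not> parallel A B" using parallel_distinct_disjoint[of A B] p q by auto
  with A show thesis using that by simp
qed

lemma two_classes: "2 \<le> card \<C>"
proof -
  obtain B where B: "B \<in> \<B>" using nonempty by auto
  obtain A where A: "A \<in> \<B>" "\<not> parallel A B" using ex_nonparallel[OF B] .
  obtain C D where CD: "C \<in> \<C>" "A \<in> C" "D \<in> \<C>" "B \<in> D"
    using ex_class[OF A(1)] ex_class[OF B] by auto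
  then have "C \<noteq> D" using A(2) by (auto simp: parallel_def)
  then show ?thesis using CD card_mono[OF finite_classes, of "{C, D}"] by simp
qed

fun separation :: "'a + 'a set \<Rightarrow> 'a + 'a set \<Rightarrow> nat" where
  "separation (Inl p) (Inl q) = (if p = q then 0 else 2)"
| "separation (Inl p) (Inr B) = (if p \<in> B then 1 else 3)"
| "separation (Inr B) (Inl p) = (if p \<in> B then 1 else 3)"
| "separation (Inr A) (Inr B) = (if A = B then 0 else if parallel A B then 4 else 2)"

abbreviation G where "G \<equiv> incidence_graph V \<B>"

lemma incidence_simps:
  "pverts G = V <+> \<B>"
  "(Inl p, Inr B) \<in> parcs G \<longleftrightarrow> p \<in> V \<and> B \<in> \<B> \<and> p \<in> B"
  "(Inr B, Inl p) \<in> parcs G \<longleftrightarrow> p \<in> V \<and> B \<in> \<B> \<and> p \<in> B"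
  "(Inl p, Inl q) \<notin> parcs G" "(Inr A, Inr B) \<notin> parcs G"
  by (auto simp: incidence_graph_def)

lemmas apath_simps = apath_with_proj_iff incidence_simps

text \<open>Parity leaves only the lengths 0, 1 and 2 to exclude: length 0 forces equality, length 1
  adjacency, and length 2 a common neighbour, which distinct parallel blocks do not have.\<close>

lemma separation_le_length:
  assumes path: "pre_digraph.apath (with_proj G) x p y"
  shows "separation x y \<le> length p"
proof -
  have w: "pcas x p y" "set p \<subseteq> parcs G"
    using path by (auto simp: apath_with_proj_iff)
  note parity = walk_length_parity[OF w]
  have 0: "x = y" if "length p = 0" using that w by simp
  have 1: "(x, y) \<in> parcs G" if "length p = 1" using that w by (cases p) auto
  have 2: "\<exists>z. (x, z) \<in> parcs G \<and> (z, y) \<in> parcs G" if "length p = 2"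
    using that w by (auto simp: length_Suc_conv numeral_2_eq_2)
  have even2: "2 \<le> l" if "even l" "l \<noteq> 0" for l :: nat using that by presburger
  have odd3: "3 \<le> l" if "odd l" "l \<noteq> 1" for l :: nat using that by presburger
  have even4: "4 \<le> l" if "even l" "l \<noteq> 0" "l \<noteq> 2" for l :: nat using that by presburger
  show ?thesis
  proof (cases x; cases y)
    fix a b assume xy: "x = Inl a" "y = Inl b"
    have "even (length p)" "a = b \<or> length p \<noteq> 0" using parity 0 xy by auto
    then show ?thesis unfolding xy separation.simps using even2[of "length p"] by auto
  next
    fix a b assume xy: "x = Inl a" "y = Inr b"
    have "odd (length p)" "a \<in> b \<or> length p \<noteq> 1" using parity 1 xy by (auto simp: incidence_simps)
    then show ?thesis unfolding xy separation.simps using odd3[of "length p"] odd_pos[of "length p"] by (auto simp: Suc_le_eq)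
  next
    fix a b assume xy: "x = Inr a" "y = Inl b"
    have "odd (length p)" "b \<in> a \<or> length p \<noteq> 1" using parity 1 xy by (auto simp: incidence_simps)
    then show ?thesis unfolding xy separation.simps using odd3[of "length p"] odd_pos[of "length p"] by (auto simp: Suc_le_eq)
  next
    fix a b assume xy: "x = Inr a" "y = Inr b"
    have "a \<inter> b \<noteq> {}" if l: "length p = 2"
    proof -
      obtain z where "(x, z) \<in> parcs G" "(z, y) \<in> parcs G" using 2[OF l] by blast
      then show ?thesis by (cases z) (auto simp: incidence_simps xy)
    qed
    then have "a = b \<or> \<not> parallel a b \<or> length p \<noteq> 2"
      using parallel_distinct_disjoint by blast
    moreover have "even (length p)" "a = b \<or> length p \<noteq> 0" using parity 0 xy by auto
    ultimately show ?thesis unfolding xy separation.simps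
      using even2[of "length p"] even4[of "length p"] by auto
  qed
qed

lemma ex_common_point:
  assumes "A \<in> \<B>" "B \<in> \<B>" "\<not> parallel A B"
  shows "\<exists>p. p \<in> A \<and> p \<in> B \<and> p \<in> V"
proof -
  have "A \<inter> B \<noteq> {}" using card_Int_nonparallel[OF assms] positive by auto
  then show ?thesis using block_subset[OF assms(1)] by blast
qed

lemma ex_path_separation:
  assumes "x \<in> V <+> \<B>" "y \<in> V <+> \<B>"
  shows "\<exists>p. pre_digraph.apath (with_proj G) x p y \<and> length p = separation x y"
proof -
  have nil: "pre_digraph.apath (with_proj G) x [] x \<and> length ([] :: (('a + 'a set) \<times> _) list) = separation x x"
    using assms(1) by (cases x) (auto simp: apath_simps)
  show ?thesis
  proof (cases x; cases y)
    fix p q assume xy: "x = Inl p" "y = Inl q"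
    show ?thesis
    proof (cases "p = q")
      case False
      then obtain B where "B \<in> \<B>" "p \<in> B" "q \<in> B" using common_block xy assms by blast
      then show ?thesis using False xy assms
        by (intro exI[of _ "[(Inl p, Inr B), (Inr B, Inl q)]"]) (auto simp: apath_simps)
    qed (use xy nil in blast)
  next
    fix p B assume xy: "x = Inl p" "y = Inr B"
    then have B: "B \<in> \<B>" and p: "p \<in> V" using assms by auto
    obtain q where q: "q \<in> B" "q \<in> V" using ex_point[OF B] by blast
    show ?thesis
    proof (cases "p \<in> B")
      case True
      then show ?thesis using xy assms
        by (intro exI[of _ "[(Inl p, Inr B)]"]) (auto simp: apath_simps)
    next
      case False
      then obtain A where "A \<in> \<B>" "p \<in> A" "q \<in> A" using common_block p q by metis
      then show ?thesis using False xy assms q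
        by (intro exI[of _ "[(Inl p, Inr A), (Inr A, Inl q), (Inl q, Inr B)]"]) (auto simp: apath_simps)
    qed
  next
    fix p B assume xy: "x = Inr B" "y = Inl p"
    then have B: "B \<in> \<B>" and p: "p \<in> V" using assms by auto
    obtain q where q: "q \<in> B" "q \<in> V" using ex_point[OF B] by blast
    show ?thesis
    proof (cases "p \<in> B")
      case True
      then show ?thesis using xy assms
        by (intro exI[of _ "[(Inr B, Inl p)]"]) (auto simp: apath_simps)
    next
      case False
      then obtain A where "A \<in> \<B>" "p \<in> A" "q \<in> A" using common_block p q by metis
      then show ?thesis using False xy assms q
        by (intro exI[of _ "[(Inr B, Inl q), (Inl q, Inr A), (Inr A, Inl p)]"]) (auto simp: apath_simps)
    qed
  next
    fix A B assume xy: "x = Inr A" "y = Inr B"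
    then have AB: "A \<in> \<B>" "B \<in> \<B>" using assms by auto
    consider "A = B" | "A \<noteq> B" "parallel A B" | "A \<noteq> B" "\<not> parallel A B" by blast
    then show ?thesis
    proof cases
      case 1
      then show ?thesis using xy nil by blast
    next
      case 2
      \<comment> \<open>A block outside their class meets both parallel blocks and so connects them.\<close>
      obtain D where D: "D \<in> \<B>" "\<not> parallel D A" using ex_nonparallel[OF AB(1)] .
      with 2 AB have D': "\<not> parallel D B"
        using class_unique by (auto simp: parallel_def)
      obtain p q where pq: "p \<in> D" "p \<in> A" "p \<in> V" "q \<in> D" "q \<in> B" "q \<in> V"
        using ex_common_point D D' AB by meson
      moreover have "A \<inter> B = {}" using 2 parallel_distinct_disjoint by blast
      moreover have "D \<noteq> A" "D \<noteq> B" using D D' parallel_refl by auto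
      ultimately show ?thesis using xy AB D 2
        by (intro exI[of _ "[(Inr A, Inl p), (Inl p, Inr D), (Inr D, Inl q), (Inl q, Inr B)]"])
          (auto simp: apath_simps)
    next
      case 3
      then obtain p where "p \<in> A" "p \<in> B" "p \<in> V" using ex_common_point AB by blast
      then show ?thesis using xy AB 3
        by (intro exI[of _ "[(Inr A, Inl p), (Inl p, Inr B)]"]) (auto simp: apath_simps)
    qed
  qed
qed

lemma graph_dist_eq_separation:
  assumes "x \<in> V <+> \<B>" "y \<in> V <+> \<B>"
  shows "graph_dist G x y = separation x y"
  using ex_path_separation[OF assms] separation_le_length by (metis graph_dist_eqI)

end

section \<open>The characteristic polynomial of the distance matrix\<close>

text \<open>The left side is the pivot \<open>s - 2v\<close> of the point block times the eigenvalue of the Schur complement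
  at the all-ones vector. Multiplying out, the terms with \<open>1/s\<close> collect to \<open>8(\<mu>v - k\<^sup>2)/s\<close>, and this
  vanishes because \<open>\<mu>v = k\<^sup>2\<close>. What remains is the characteristic polynomial of the distance matrix on
  the span of the two vectors that are constant on points and constant on blocks.\<close>

lemma quadratic_factor_identity:
  fixes t k v n b \<mu> :: real
  defines "s \<equiv> t + 2"
  defines "\<rho> \<equiv> (4 * k / s - 3) / (s - 2 * v)"
  assumes s: "s \<noteq> 0" "s - 2 * v \<noteq> 0" and k: "k\<^sup>2 = \<mu> * v" and nk: "n * \<mu> = k"
  shows "(s - 2 * v) * ((t + 4 - 4 * k / s) + n * (4 * \<mu> / s - 2) +
     b * (6 * k / s + 3 * \<rho> * v - 2 - 4 * \<mu> / s - 2 * \<rho> * k)) =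
   (t - 2 * v + 2) * (t - 2 * b - 2 * n + 4) - b * (9 * v - 12 * k + 4 * \<mu>)"
proof -
  have \<rho>: "(s - 2 * v) * \<rho> = 4 * k / s - 3" using s by (simp add: \<rho>_def)
  have 1: "(t + 4 - 4 * k / s) + n * (4 * \<mu> / s - 2) = t + 4 - 2 * n"
    using nk by (simp add: algebra_simps flip: nk)
  have "(s - 2 * v) * (6 * k / s + 3 * \<rho> * v - 2 - 4 * \<mu> / s - 2 * \<rho> * k) =
    (s - 2 * v) * (6 * k / s - 2 - 4 * \<mu> / s) + (3 * v - 2 * k) * ((s - 2 * v) * \<rho>)"
    by (simp add: algebra_simps)
  also have "\<dots> = - 2 * (s - 2 * v) - (9 * v - 12 * k + 4 * \<mu>) + 8 * (\<mu> * v - k\<^sup>2) / s"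
    unfolding \<rho> using s(1) by (simp add: field_simps power2_eq_square)
  finally have 2: "(s - 2 * v) * (6 * k / s + 3 * \<rho> * v - 2 - 4 * \<mu> / s - 2 * \<rho> * k) =
    - 2 * (s - 2 * v) - (9 * v - 12 * k + 4 * \<mu>)" using k by simp
  have "(s - 2 * v) * ((t + 4 - 2 * n) +
     b * (6 * k / s + 3 * \<rho> * v - 2 - 4 * \<mu> / s - 2 * \<rho> * k)) =
     (s - 2 * v) * (t + 4 - 2 * n) + b * ((s - 2 * v) * (6 * k / s + 3 * \<rho> * v - 2 - 4 * \<mu> / s - 2 * \<rho> * k))"
    by (simp add: algebra_simps)
  then show ?thesis unfolding 1 2 by (simp add: s_def algebra_simps)
qed

context affine_resolution
begin

lemma sum_indicator_points:
  assumes "B \<in> \<B>"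
  shows "(\<Sum>p\<in>V. of_bool (p \<in> B)) = real k"
  using assms finite_points block_subset[OF assms] card_block[OF assms]
  by (simp add: of_bool_def sum.If_cases Int_absorb1)

lemma sum_indicator_Int:
  assumes "A \<in> \<B>" "B \<in> \<B>"
  shows "(\<Sum>p\<in>V. of_bool (p \<in> A) * of_bool (p \<in> B)) = real (card (A \<inter> B))"
proof -
  have "(\<Sum>p\<in>V. of_bool (p \<in> A) * of_bool (p \<in> B)) = (\<Sum>p\<in>V. if p \<in> A \<inter> B then 1 else 0 :: real)"
    by (rule sum.cong) auto
  also have "\<dots> = real (card (A \<inter> B))"
  proof -
    have "V \<inter> {p. p \<in> A \<inter> B} = A \<inter> B" using block_subset[OF assms(1)] by auto
    then show ?thesis using finite_points by (simp add: sum.If_cases)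
  qed
  finally show ?thesis .
qed

text \<open>On the blocks, the identity, the all-ones matrix \<open>J\<close> and the matrix \<open>K\<close> of parallelism span an
  algebra with three common eigenspaces: vectors summing to zero on each class, vectors constant on
  classes with sum zero, and constants. The determinant follows without any eigenvectors by applying
  Sylvester's identity to the incidence matrix of blocks and classes: as each block lies in one class
  and each class has \<open>n\<close> blocks, the problem moves to the classes, where \<open>K\<close> becomes the scalar \<open>n\<close> and
  \<open>J\<close> has rank one.\<close>

lemma det_parallel_algebra:
  fixes \<alpha> \<beta> \<gamma> :: real
  assumes bs: "distinct bs" "set bs = \<B>" and \<alpha>: "\<alpha> \<noteq> 0" and n\<gamma>: "\<alpha> + n * \<gamma> \<noteq> 0"
  shows "det (tab bs bs (\<lambda>A B. (if A = B then \<alpha> else 0) + (\<beta> + \<gamma> * of_bool (parallel A B)))) =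
    \<alpha> ^ (card \<B> - card \<C>) * (\<alpha> + n * \<gamma>) ^ (card \<C> - 1) * (\<alpha> + n * \<gamma> + card \<B> * \<beta>)"
proof -
  obtain cs where cs: "distinct cs" "set cs = \<C>"
    using finite_classes finite_distinct_list by blast
  define u :: "'a set \<Rightarrow> 'a set set \<Rightarrow> real" where "u A C = of_bool (A \<in> C)" for A C
  define w where "w C B = \<beta> + \<gamma> * of_bool (B \<in> C)" for C and B :: "'a set"
  have uw: "(\<Sum>C\<in>set cs. u A C * w C B) = \<beta> + \<gamma> * of_bool (parallel A B)"
    if A: "A \<in> \<B>" for A B
  proof -
    obtain C where C: "C \<in> \<C>" "A \<in> C" using ex_class[OF A] by auto
    then have C': "A \<in> D \<longleftrightarrow> D = C" if "D \<in> \<C>" for D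
      using class_unique[OF that C(1) _ C(2)] by auto
    have "(\<Sum>D\<in>\<C>. u A D * w D B) = (\<Sum>D\<in>\<C>. if D = C then w C B else 0)"
      by (intro sum.cong) (auto simp: u_def C')
    also have "\<dots> = w C B" using C(1) finite_classes by simp
    also have "B \<in> C \<longleftrightarrow> parallel A B" using C C' by (auto simp: parallel_def)
    then have "w C B = \<beta> + \<gamma> * of_bool (parallel A B)" by (simp add: w_def)
    finally show ?thesis by (simp add: cs)
  qed
  have wu: "(\<Sum>A\<in>set bs. w C A * u A D) = n * \<beta> + (if C = D then n * \<gamma> else 0)"
    if CD: "C \<in> \<C>" "D \<in> \<C>" for C D
  proof -
    have "(\<Sum>A\<in>\<B>. w C A * u A D) = (\<Sum>A\<in>D. w C A)"
      using class_subset[OF CD(2)] finite_blocks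
      by (intro sum.mono_neutral_cong_right) (auto simp: u_def)
    also have "\<dots> = (\<Sum>A\<in>D. \<beta> + (if C = D then \<gamma> else 0))"
    proof (rule sum.cong)
      fix A assume "A \<in> D"
      then have "A \<in> C \<longleftrightarrow> C = D" using class_unique[OF CD, of A] by auto
      then show "w C A = \<beta> + (if C = D then \<gamma> else 0)" by (simp add: w_def)
    qed simp
    finally show ?thesis using card_class[OF CD(2)] bs(2) by (simp add: algebra_simps)
  qed
  \<comment> \<open>The factor by which Sylvester's identity scales the identity on classes.\<close>
  define \<delta> where "\<delta> = 1 + n * \<gamma> / \<alpha>"
  have \<alpha>\<delta>: "\<alpha> * \<delta> = \<alpha> + n * \<gamma>" and \<delta>: "\<delta> \<noteq> 0"
    using \<alpha> n\<gamma> by (auto simp: \<delta>_def field_simps)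
  have len: "length bs = card \<B>" "length cs = card \<C>"
    using distinct_card[OF bs(1)] distinct_card[OF cs(1)] bs(2) cs(2) by simp_all
  have "det (tab bs bs (\<lambda>A B. (if A = B then \<alpha> else 0) + (\<beta> + \<gamma> * of_bool (parallel A B)))) =
    det (tab bs bs (\<lambda>A B. (if A = B then \<alpha> else 0) + (\<Sum>C\<in>set cs. u A C * w C B)))"
    by (intro arg_cong[where f = det] tab_cong) (use bs in \<open>auto simp: uw\<close>)
  also have "\<dots> = \<alpha> ^ card \<B> *
     det (tab cs cs (\<lambda>C D. (if C = D then 1 else 0) + (\<Sum>A\<in>set bs. w C A * u A D) / \<alpha>))"
    using det_tab_Sylvester[OF bs(1) cs(1) \<alpha>] len by simp
  also have "tab cs cs (\<lambda>C D. (if C = D then 1 else 0) + (\<Sum>A\<in>set bs. w C A * u A D) / \<alpha>) =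
     tab cs cs (\<lambda>C D. (if C = D then \<delta> else 0) + n * \<beta> / \<alpha>)"
  proof (rule tab_cong)
    fix C D assume "C \<in> set cs" "D \<in> set cs"
    then have "C \<in> \<C>" "D \<in> \<C>" using cs by auto
    then show "(if C = D then 1 else 0) + (\<Sum>A\<in>set bs. w C A * u A D) / \<alpha> =
        (if C = D then \<delta> else 0) + n * \<beta> / \<alpha>"
      by (subst wu) (simp_all add: \<delta>_def add_divide_distrib)
  qed
  also have "det \<dots> = \<delta> ^ card \<C> * (1 + card \<C> * (n * \<beta> / \<alpha>) / \<delta>)"
    using det_tab_scalar_plus_constant[OF cs(1) \<delta>] len by simp
  also have "\<alpha> ^ card \<B> = \<alpha> ^ (card \<B> - card \<C>) * \<alpha> ^ (card \<C> - 1) * \<alpha>"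
  proof -
    have "n \<ge> 1" using positive block_size by (cases n) auto
    then have "card \<B> = (card \<B> - card \<C>) + ((card \<C> - 1) + 1)"
      using two_classes card_blocks by (cases n) auto
    then have "\<alpha> ^ card \<B> = \<alpha> ^ ((card \<B> - card \<C>) + ((card \<C> - 1) + 1))"
      by (rule arg_cong)
    then show ?thesis by (simp only: power_add power_one_right mult.assoc)
  qed
  also have "\<delta> ^ card \<C> = \<delta> ^ (card \<C> - 1) * \<delta>"
    using two_classes by (subst power_minus_mult) auto
  also have "1 + card \<C> * (n * \<beta> / \<alpha>) / \<delta> = 1 + card \<B> * \<beta> / (\<alpha> * \<delta>)"
    by (simp add: card_blocks)
  also have "\<alpha> ^ (card \<B> - card \<C>) * \<alpha> ^ (card \<C> - 1) * \<alpha> *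
     (\<delta> ^ (card \<C> - 1) * \<delta> * (1 + card \<B> * \<beta> / (\<alpha> * \<delta>))) =
     \<alpha> ^ (card \<B> - card \<C>) * (\<alpha> * \<delta>) ^ (card \<C> - 1) * (\<alpha> * \<delta> + card \<B> * \<beta>)"
  proof -
    have factor: "\<alpha> * \<delta> * (1 + card \<B> * \<beta> / (\<alpha> * \<delta>)) = \<alpha> * \<delta> + card \<B> * \<beta>"
      using \<alpha> \<delta> by (simp add: distrib_left)
    then show ?thesis by (simp only: power_mult_distrib flip: factor) (simp only: mult_ac)
  qed
  finally show ?thesis unfolding \<alpha>\<delta> .
qed

text \<open>The point block of \<open>t - D\<close> is \<open>s - 2J\<close> with \<open>s = t + 2\<close>, and the mixed block is \<open>2N - 3J\<close> for the incidence
  matrix \<open>N\<close>. Since columns of \<open>N\<close> sum to \<open>k\<close>, the pivot equation has a solution of the form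
  \<open>(2/s)N + \<rho>J\<close>, and since \<open>N\<^sup>T N\<close> is a combination of the identity, \<open>J\<close> and \<open>K\<close>, so is the Schur complement.
  The bound on \<open>t\<close> keeps all pivots away from zero.\<close>

lemma det_separation:
  fixes t :: real
  defines "v \<equiv> card V" and "b \<equiv> card \<B>" and "r \<equiv> card \<C>"
  assumes vs: "distinct vs" "set vs = V" and bs: "distinct bs" "set bs = \<B>"
    and br: "b + 1 = v + r"
    and t: "t > 2 * v + 2 * n + 4 * k"
  shows "det (tab (map Inl vs @ map Inr bs) (map Inl vs @ map Inr bs)
      (\<lambda>x y. (if x = y then t else 0) - separation x y)) =
    (t\<^sup>2 + 6 * t + (8 - 4 * real k)) ^ (v - 1) * (t - (2 * real n - 4)) ^ (r - 1) *
    ((t - 2 * real v + 2) * (t - 2 * real b - 2 * real n + 4) - real b * (9 * real v - 12 * real k + 4 * real \<mu>))"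
proof -
  define s where "s = t + 2"
  \<comment> \<open>the coefficient of \<open>J\<close> in the solution of the pivot equation\<close>
  define \<rho> where "\<rho> = (4 * k / s - 3) / (s - 2 * v)"
  \<comment> \<open>the coefficients of the identity, \<open>J\<close> and \<open>K\<close> in the Schur complement\<close>
  define \<alpha> where "\<alpha> = t + 4 - 4 * real k / s"
  define \<beta> where "\<beta> = 6 * k / s + 3 * \<rho> * v - 2 - 4 * \<mu> / s - 2 * \<rho> * k"
  define \<gamma> where "\<gamma> = 4 * \<mu> / s - 2"
  define a where "a p q = (if p = q then s else 0) + (- 2)" for p q :: 'a
  define c where "c p B = 2 * of_bool (p \<in> B) - (3::real)" for p :: 'a and B
  define d where "d A B = (if A = B then t else 0) - real (separation (Inr A) (Inr B))" for A B
  define u where "u p B = (2 / s) * of_bool (p \<in> B) + \<rho>" for p :: 'a and B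
  have pos: "s > 0" "s - 2 * v > 0" "t - (2 * real n - 4) > 0"
    using t by (auto simp: s_def)
  have v: "v = n * k" "v \<ge> 1"
    using card_points positive block_size by (auto simp: v_def Suc_le_eq)
  have sq: "s * \<alpha> = t\<^sup>2 + 6 * t + (8 - 4 * real k)"
    using pos by (simp add: \<alpha>_def s_def field_simps power2_eq_square)
  have n\<gamma>: "\<alpha> + n * \<gamma> = t - (2 * real n - 4)"
    using block_size by (simp add: \<alpha>_def \<gamma>_def algebra_simps block_size)
  have \<alpha>: "\<alpha> \<noteq> 0"
  proof -
    have "t\<^sup>2 + 6 * t + (8 - 4 * real k) > 0" using t zero_le_power2[of t] by linarith
    then show ?thesis using sq by auto
  qed
  have sum_u: "(\<Sum>p\<in>V. u p B) = 2 / s * k + \<rho> * v" if "B \<in> \<B>" for B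
    unfolding u_def sum.distrib sum_distrib_left[symmetric] sum_indicator_points[OF that]
    by (simp add: v_def)
  have upper: "c p B = (\<Sum>q\<in>set vs. a p q * u q B)" if "p \<in> V" "B \<in> \<B>" for p B
  proof -
    have "(\<Sum>q\<in>V. a p q * u q B) = (\<Sum>q\<in>V. (if p = q then s * u q B else 0)) - 2 * (\<Sum>q\<in>V. u q B)"
      unfolding sum_distrib_left sum_subtractf[symmetric]
      by (intro sum.cong refl) (simp add: a_def algebra_simps)
    also have "\<dots> = s * u p B - 2 * (2 / s * k + \<rho> * v)"
      using that finite_points by (simp add: sum_u)
    also have "\<dots> = 2 * of_bool (p \<in> B) + (s - 2 * v) * \<rho> - 4 * k / s"
      using pos by (simp add: u_def field_simps)
    also have "(s - 2 * v) * \<rho> = 4 * k / s - 3" using pos by (simp add: \<rho>_def)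
    finally show ?thesis by (simp add: vs c_def)
  qed
  have schur: "d A B - (\<Sum>p\<in>set vs. c p A * u p B) =
     (if A = B then \<alpha> else 0) + (\<beta> + \<gamma> * of_bool (parallel A B))" if AB: "A \<in> \<B>" "B \<in> \<B>" for A B
  proof -
    have "(\<Sum>p\<in>V. c p A * u p B) = (\<Sum>p\<in>V. 4 / s * (of_bool (p \<in> A) * of_bool (p \<in> B)) + 2 * \<rho> * of_bool (p \<in> A) - 3 * u p B)"
      by (intro sum.cong) (auto simp: c_def u_def algebra_simps)
    also have "\<dots> = 4 / s * card (A \<inter> B) + 2 * \<rho> * k - 3 * (2 / s * k + \<rho> * v)"
      by (simp only: sum.distrib sum_subtractf sum_distrib_left[symmetric] sum_u[OF AB(2)]
        sum_indicator_points[OF AB(1)] sum_indicator_Int[OF AB])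
    finally have sum: "(\<Sum>p\<in>set vs. c p A * u p B) =
        4 / s * card (A \<inter> B) + 2 * \<rho> * k - 3 * (2 / s * k + \<rho> * v)"
      by (simp add: vs)
    have "s \<noteq> 0" using pos by simp
    consider "A = B" "parallel A B" | "A \<noteq> B" "parallel A B" | "A \<noteq> B" "\<not> parallel A B"
      using parallel_refl[OF AB(1)] by blast
    then show ?thesis
      unfolding sum card_Int_blocks[OF AB] d_def \<alpha>_def \<beta>_def \<gamma>_def
      by cases (simp_all add: \<open>s \<noteq> 0\<close> field_simps)
  qed
  have lenv: "length vs = v" using distinct_card[OF vs(1)] vs(2) by (simp add: v_def)
  have "det (tab (map Inl vs @ map Inr bs) (map Inl vs @ map Inr bs)
      (\<lambda>x y. (if x = y then t else 0) - separation x y)) =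
    det (four_block_mat (tab vs vs a) (tab vs bs c) (tab bs vs (\<lambda>B p. c p B)) (tab bs bs d))"
    unfolding tab_sum
    by (intro arg_cong[where f = det] cong_four_block_mat tab_cong) (auto simp: a_def c_def d_def s_def)
  also have "\<dots> = det (tab vs vs a) * det (tab bs bs (\<lambda>A B. d A B - (\<Sum>p\<in>set vs. c p A * u p B)))"
    by (rule det_tab_Schur[OF vs(1)]) (use upper vs bs in auto)
  also have "tab bs bs (\<lambda>A B. d A B - (\<Sum>p\<in>set vs. c p A * u p B)) =
     tab bs bs (\<lambda>A B. (if A = B then \<alpha> else 0) + (\<beta> + \<gamma> * of_bool (parallel A B)))"
    by (rule tab_cong) (use schur bs in auto)
  also have "det \<dots> = \<alpha> ^ (b - r) * (\<alpha> + n * \<gamma>) ^ (r - 1) * (\<alpha> + n * \<gamma> + b * \<beta>)"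
    unfolding b_def r_def by (rule det_parallel_algebra) (use bs \<alpha> n\<gamma> pos in auto)
  \<comment> \<open>The powers of \<open>s\<close> from the point block cancel the denominators of the powers of \<open>\<alpha>\<close>.\<close>
  also have "b - r = v - 1" using br by simp
  also have "det (tab vs vs a) = s ^ v * (1 + v * (- 2) / s)"
    unfolding a_def using det_tab_scalar_plus_constant[OF vs(1), of s "- 2"] pos lenv by simp
  also have "\<dots> = s ^ (v - 1) * (s - 2 * v)"
    using pos v(2) by (simp add: power_eq_if field_simps)
  also have "s ^ (v - 1) * (s - 2 * v) * (\<alpha> ^ (v - 1) * (\<alpha> + n * \<gamma>) ^ (r - 1) * (\<alpha> + n * \<gamma> + b * \<beta>)) =
     (s * \<alpha>) ^ (v - 1) * (\<alpha> + n * \<gamma>) ^ (r - 1) * ((s - 2 * v) * (\<alpha> + n * \<gamma> + b * \<beta>))"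
    by (simp add: power_mult_distrib)
  also have "(s - 2 * v) * (\<alpha> + n * \<gamma> + b * \<beta>) =
     (t - 2 * real v + 2) * (t - 2 * real b - 2 * real n + 4) - real b * (9 * real v - 12 * real k + 4 * real \<mu>)"
    unfolding \<alpha>_def \<beta>_def \<gamma>_def \<rho>_def s_def of_nat_mult of_nat_numeral
  proof (rule quadratic_factor_identity)
    show "(real k)\<^sup>2 = real \<mu> * real v"
      using v block_size by (simp add: power2_eq_square)
    show "real n * real \<mu> = real k" by (simp add: block_size)
  qed (use pos in \<open>auto simp: s_def\<close>)
  finally show ?thesis unfolding sq n\<gamma> .
qed

lemma char_poly_distance_matrix:
  defines "v \<equiv> card V" and "b \<equiv> card \<B>" and "r \<equiv> card \<C>"
  assumes xs: "distinct xs" "set xs = V <+> \<B>" and br: "b + 1 = v + r"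
    and q: "\<And>t. t\<^sup>2 + 6 * t + (8 - 4 * real k) = (t - x1) * (t - x2)"
    and Q: "\<And>t. (t - 2 * real v + 2) * (t - 2 * real b - 2 * real n + 4) - real b * (9 * real v - 12 * real k + 4 * real \<mu>) = (t - y1) * (t - y2)"
  shows "char_poly (distance_matrix G xs) = (\<Prod>a \<leftarrow> replicate (r - 1) (2 * real n - 4) @
     replicate (v - 1) x1 @ replicate (v - 1) x2 @ [y1, y2]. [:- a, 1:])"
proof -
  obtain vs where vs: "distinct vs" "set vs = V"
    using finite_points finite_distinct_list by blast
  obtain bs where bs: "distinct bs" "set bs = \<B>"
    using finite_blocks finite_distinct_list by blast
  let ?zs = "map Inl vs @ map Inr bs :: ('a + 'a set) list"
  have zs: "distinct ?zs" "set xs = set ?zs"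
    using vs bs xs by (auto simp: distinct_map)
  have "distance_matrix G xs = tab xs xs (\<lambda>x y. real (graph_dist G x y))"
    by (simp add: distance_matrix_def tab_def)
  also have "\<dots> = tab xs xs (\<lambda>x y. real (separation x y))"
    by (rule tab_cong) (use xs graph_dist_eq_separation in auto)
  finally have "char_poly (distance_matrix G xs) = char_poly (tab ?zs ?zs (\<lambda>x y. real (separation x y)))"
    using char_poly_tab_permute[OF xs(1) zs] by simp
  also have "\<dots> = (\<Prod>a \<leftarrow> replicate (r - 1) (2 * real n - 4) @
     replicate (v - 1) x1 @ replicate (v - 1) x2 @ [y1, y2]. [:- a, 1:])" (is "?p = ?f")
  proof (rule poly_eqI_large)
    fix t :: real assume t: "t > real (2 * v + 2 * n + 4 * k)"
    have pow: "poly (\<Prod>a \<leftarrow> as. [:- a, 1:]) t = (\<Prod>a \<leftarrow> as. t - a)" for as :: "real list"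
      by (induction as) (auto simp: algebra_simps)
    have "poly ?p t = (t\<^sup>2 + 6 * t + (8 - 4 * real k)) ^ (v - 1) * (t - (2 * real n - 4)) ^ (r - 1) *
      ((t - 2 * real v + 2) * (t - 2 * real b - 2 * real n + 4) - real b * (9 * real v - 12 * real k + 4 * real \<mu>))"
      unfolding poly_char_poly_tab[OF zs(1)] v_def b_def r_def
      by (rule det_separation[OF vs bs]) (use br t in \<open>auto simp: v_def b_def r_def\<close>)
    also have "\<dots> = poly ?f t"
      unfolding pow q Q by (simp add: power_mult_distrib mult_ac)
    finally show "poly ?p t = poly ?f t" .
  qed
  finally show ?thesis .
qed

end

section \<open>The signature\<close>

text \<open>This is the determinant of the distance matrix on the span of the two constant vectors. With
  \<open>9v - 12k + 4\<mu> = \<mu>(3n - 2)\<^sup>2\<close> and \<open>v = n\<^sup>2\<mu>\<close> its terms of highest degree combine to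
  \<open>-(n - 2)(5n - 2)b\<mu>\<close>, which outweighs the positive term \<open>4(n - 2)v\<close> as soon as \<open>v \<le> b\<close>; the strict
  inequality comes from a further term \<open>-4b\<close>.\<close>

lemma determinant_on_constants_negative:
  fixes n \<mu> b :: nat
  assumes n: "2 \<le> n" and b: "0 < b" "n\<^sup>2 * \<mu> \<le> b"
  defines "v \<equiv> real (n\<^sup>2 * \<mu>)" and "k \<equiv> real (n * \<mu>)"
  shows "(2 * v - 2) * (2 * real b + 2 * real n - 4) - real b * (9 * v - 12 * k + 4 * real \<mu>) < 0"
proof -
  have eq: "(2 * v - 2) * (2 * real b + 2 * real n - 4) - real b * (9 * v - 12 * k + 4 * real \<mu>) =
    - (4 * real b) - 4 * (real n - 2) - (real n - 2) * (real b * \<mu> * (5 * real n - 2) - 4 * v)"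
    using n by (simp add: v_def k_def power2_eq_square algebra_simps)
  have "4 * v \<le> real b * \<mu> * (5 * real n - 2)"
  proof -
    have "real (n\<^sup>2 * \<mu>) \<le> real b" using b(2) by (simp only: of_nat_le_iff)
    moreover have "1 * 4 \<le> real \<mu> * (5 * real n - 2)" if "\<mu> > 0"
      using n that by (intro mult_mono) auto
    ultimately show ?thesis
      using mult_mono[of v "real b" 4 "real \<mu> * (5 * real n - 2)"]
      by (cases "\<mu> = 0") (auto simp: v_def mult_ac)
  qed
  then have "0 \<le> (real n - 2) * (real b * \<mu> * (5 * real n - 2) - 4 * v)"
    using n by (intro mult_nonneg_nonneg) auto
  moreover have "0 < 4 * real b" "0 \<le> 4 * (real n - 2)" using n b by auto
  ultimately show ?thesis unfolding eq by argo
qed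

theorem theorem1:
  fixes V :: "'a set" and \<B> :: "'a set set"
    and v k l b n \<mu> :: nat
    and xs :: "('a + 'a set) list"
  assumes "n \<ge> 2" and "\<mu> \<ge> 1"
    and "affine_design V \<B> v k l \<mu>"
    and "v = n\<^sup>2 * \<mu>"
    and "b = card \<B>"
    and "real b = (real n ^ 3 * real \<mu> - real n) / (real n - 1)"
    and "real n = real v / real k"
    and "distinct xs" and "set xs = pverts (incidence_graph V \<B>)"
  shows "signature (distance_matrix (incidence_graph V \<B>) xs) =
    (if n = 2 \<and> \<mu> = 1 then (1, 4, 5)
     else if n = 2 \<and> \<mu> \<ge> 2 then (4 * \<mu>, 4 * \<mu>, 4 * \<mu> - 2)
     else (b, v, 0))"
proof -
  note n = assms(1) and \<mu> = assms(2)
  obtain \<C> where des: "vkl_design V \<B> v k l" and res: "resolution V \<B> \<C>"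
    and int: "\<forall>C\<in>\<C>. \<forall>D\<in>\<C>. C \<noteq> D \<longrightarrow> (\<forall>A\<in>C. \<forall>B\<in>D. card (A \<inter> B) = \<mu>)"
    using assms(3) by (auto simp: affine_design_def)
  have fin: "finite V" and sub: "\<And>B. B \<in> \<B> \<Longrightarrow> B \<subseteq> V" and cv: "card V = v"
    and ck: "\<And>B. B \<in> \<B> \<Longrightarrow> card B = k"
    and pairs: "\<And>S. S \<subseteq> V \<Longrightarrow> card S = 2 \<Longrightarrow> card {B \<in> \<B>. S \<subseteq> B} = l"
    using des by (auto simp: vkl_design_def)
  have k0: "k > 0" using assms(7) n by (cases k) auto
  then have "real v = real (n * k)" using assms(7) by (simp add: field_simps)
  then have vk: "v = n * k" by (simp only: of_nat_eq_iff)
  then have k: "k = n * \<mu>" using assms(4) n by (simp add: power2_eq_square)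
  \<comment> \<open>The given value of \<open>b\<close>, cleared of its denominator: \<open>b(n - 1) = n(v - 1)\<close>. With \<open>b = nr\<close> it becomes \<open>b + 1 = v + r\<close>.\<close>
  have "real b * (real n - 1) = real n * (real v - 1)"
    using assms(6) n by (simp add: assms(4) field_simps power2_eq_square power3_eq_cube)
  then have "real (b * n + n) = real (n * v + b)"
    by (simp add: algebra_simps)
  then have bn: "b * n + n = n * v + b" by (simp only: of_nat_eq_iff)
  have v4: "v \<ge> 4" using n \<mu> power_mono[of 2 n 2] mult_mono[of 4 "n\<^sup>2" 1 \<mu>] by (simp add: assms(4))
  have b0: "b > 0" using bn n v4 by (cases b) auto
  have "finite \<B>" using fin sub by (meson PowI finite_Pow_iff finite_subset subsetI)
  \<comment> \<open>A block has \<open>k = n\<mu> \<ge> 2\<close> points, and any two of them form a pair that is covered.\<close>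
  have l0: "l > 0"
  proof -
    obtain B where B: "B \<in> \<B>" using b0 assms(5) by fastforce
    have "2 \<le> card B" using ck[OF B] k n \<mu> mult_mono[of 2 n 1 \<mu>] by simp
    then obtain S where S: "S \<subseteq> B" "card S = 2" by (meson obtain_subset_with_card_n)
    then have "card {B \<in> \<B>. S \<subseteq> B} > 0"
      using B \<open>finite \<B>\<close> by (subst card_gt_0_iff) auto
    then show ?thesis using pairs[of S] S sub[OF B] by auto
  qed
  have joined: "\<exists>B\<in>\<B>. p \<in> B \<and> q \<in> B" if "p \<in> V" "q \<in> V" "p \<noteq> q" for p q
  proof -
    have "card {B \<in> \<B>. {p, q} \<subseteq> B} > 0" using pairs[of "{p, q}"] that l0 by simp
    then show ?thesis by (auto simp: card_gt_0_iff)
  qed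
  interpret affine_resolution V \<B> \<C> k n \<mu>
    by unfold_locales (use fin sub ck res int cv vk k k0 \<mu> n b0 assms(5) joined in auto)
  define r where "r = card \<C>"
  have bnr: "b = n * r" using card_blocks by (simp add: r_def assms(5))
  have br: "b + 1 = v + r"
  proof -
    have "n * (b + 1) = n * (v + r)" using bn bnr by (simp add: algebra_simps)
    then show ?thesis using n mult_left_cancel[of n "b + 1" "v + r"] by simp
  qed
  let ?D = "distance_matrix G xs"
  have carrier: "?D \<in> carrier_mat (length xs) (length xs)" by (simp add: distance_matrix_def)
  obtain x1 x2 where q: "\<And>t. t\<^sup>2 + 6 * t + (8 - 4 * real k) = (t - x1) * (t - x2)"
    and x: "x1 * x2 = 8 - 4 * real k" "x1 + x2 = - 6"
    by (rule monic_quadratic_factors[of "8 - 4 * real k" 6]) auto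
  \<comment> \<open>the constant term of the quadratic polynomial belonging to the constant vectors\<close>
  define c where "c = (2 * real v - 2) * (2 * real b + 2 * real n - 4) - real b * (9 * real v - 12 * real k + 4 * real \<mu>)"
  have c: "c < 0"
    using determinant_on_constants_negative[of n b \<mu>] n b0 br two_classes
    by (simp add: c_def k assms(4) r_def)
  obtain y1 y2 where Q': "\<And>t. t\<^sup>2 + (6 - 2 * real v - 2 * real b - 2 * n) * t + c = (t - y1) * (t - y2)"
    and y: "y1 * y2 = c"
    by (rule monic_quadratic_factors[of c "6 - 2 * real v - 2 * real b - 2 * n"])
      (use c in \<open>auto intro: order_trans[OF _ zero_le_power2]\<close>)
  have Q: "(t - 2 * real v + 2) * (t - 2 * real b - 2 * real n + 4) - real b * (9 * real v - 12 * real k + 4 * real \<mu>) = (t - y1) * (t - y2)" for t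
    unfolding Q'[symmetric] c_def by (simp add: power2_eq_square algebra_simps)
  have count: "num_eigenvalues P ?D = (if P (2 * real n - 4) then r - 1 else 0) + (if P x1 then v - 1 else 0)
     + (if P x2 then v - 1 else 0) + (if P y1 then 1 else 0) + (if P y2 then 1 else 0)" for P
    by (subst num_eigenvalues_linear_factors[OF carrier char_poly_distance_matrix[of xs x1 x2 y1 y2]])
      (use assms(5,8,9) br q Q in \<open>auto simp: r_def cv incidence_simps\<close>)
  have ysign: "(y1 < 0 \<and> 0 < y2) \<or> (0 < y1 \<and> y2 < 0)"
    using y c mult_less_0_iff[of y1 y2] by auto
  have n4: "2 * real n - 4 = 0 \<longleftrightarrow> n = 2" "2 * real n - 4 > 0 \<longleftrightarrow> n \<noteq> 2" "\<not> 2 * real n - 4 < 0"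
    using n by auto
  show ?thesis
  proof (cases "n = 2 \<and> \<mu> = 1")
    case True
    then have "x1 * x2 = 0" using x(1) k by simp
    then have "(x1 = 0 \<and> x2 = -6) \<or> (x1 = -6 \<and> x2 = 0)" using x(2) by auto
    moreover have "v = 4" "r = 3" using True assms(4) bnr br by auto
    ultimately show ?thesis
      using True ysign by (auto simp: signature_def count)
  next
    case False
    have "k > 2"
    proof (cases "n = 2")
      case True
      then show ?thesis using False \<mu> k by simp
    next
      case n2: False
      then show ?thesis using n \<mu> k mult_mono[of 3 n 1 \<mu>] by simp
    qed
    then have xsign: "(x1 < 0 \<and> 0 < x2) \<or> (0 < x1 \<and> x2 < 0)"
      using x(1) mult_less_0_iff[of x1 x2] by auto
    have eq: "signature ?D = ((if n = 2 then 0 else r - 1) + v, v, if n = 2 then r - 1 else 0)"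
      using xsign ysign v4 n4 by (auto simp: signature_def count)
    show ?thesis
    proof (cases "n = 2")
      case True
      then have "v = 4 * \<mu>" "r = 4 * \<mu> - 1" using assms(4) bnr br by auto
      then show ?thesis using eq True False \<mu> by auto
    next
      case n2: False
      then show ?thesis using eq br two_classes by (auto simp: r_def)
    qed
  qed
qed

end
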